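(* Let $n,m$ be positive integers. Then $R_{n:m}\colon \mathbb{C}_\times^2\to\mathbb{R}$ and $\mathbf{J}_{n:m}\colon \mathbb{C}_\times^2\to\mathfrak{su}(2)^*_+$ are Poisson maps and form a dual pair; that is, for every $\mathbf{a}\in\mathbb{C}_\times^2$, the subspaces $\ker T_{\mathbf{a}}R_{n:m}$ and $\ker T_{\mathbf{a}}\mathbf{J}_{n:m}$ of $T_{\mathbf{a}}\mathbb{C}_\times^2$ are symplectic orthogonal complements of each other with respect to $\Omega$. Moreover, this dual pair is related to the dual pair $R_{1:1},\mathbf{J}_{1:1}$ through the map $f_{n:m}$: $$R_{n:m}=R_{1:1}\circ f_{n:m},\qquad \mathbf{J}_{n:m}=\mathbf{J}_{1:1}\circ f_{n:m}.$$
   Context: $\mathbb{C}_\times=\mathbb{C}\setminus\{0\}$ and $\mathbb{C}_\times^2=\{\mathbf{a}=(a_1,a_2): a_1,a_2\in\mathbb{C}_\times\}$, regarded as a real 4-dimensional manifold with symplectic form $\Omega=-\frac{i}{2}\sum_{j=1}^2 da_j\wedge d\bar a_j$ and associated Poisson bracket $$\{F,G\}=2i\sum_{j=1}^2\left(\frac{\partial F}{\partial a_j}\frac{\partial G}{\partial\bar a_j}-\frac{\partial G}{\partial a_j}\frac{\partial F}{\partial\bar a_j}\right).$$ $\mathbb{R}$ carries the zero Poisson bracket. For positive integers $n,m$ define $$f_{n:m}\colon\mathbb{C}_\times^2\to\mathbb{C}_\times^2,\quad (a_1,a_2)\mapsto\left(\frac{a_1^m}{\sqrt m\,|a_1|^{m-1}},\frac{a_2^n}{\sqrt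 n\,|a_2|^{n-1}}\right),$$ $$R_{n:m}(\mathbf{a})=\frac12\left(\frac{|a_1|^2}{m}+\frac{|a_2|^2}{n}\right).$$ Identify $\mathfrak{su}(2)$ with $\mathbb{R}^3$ by $i\begin{bmatrix}\xi_3&\xi_1+i\xi_2\\ \xi_1-i\xi_2&-\xi_3\end{bmatrix}\leftrightarrow(\xi_1,\xi_2,\xi_3)$, and $\mathfrak{su}(2)^*$ with $\mathfrak{su}(2)\cong\mathbb{R}^3$ via the inner product $\langle\xi,\eta\rangle=\frac12\operatorname{tr}(\xi^*\eta)$ (the Euclidean dot product). $\mathfrak{su}(2)^*_+$ denotes $\mathfrak{su}(2)^*$ with the $(+)$-Lie--Poisson bracket $\{F,G\}_+(\mu)=\langle\mu,[\partial F/\partial\mu,\partial G/\partial\mu]\rangle=2\boldsymbol{\mu}\cdot(\nabla F(\boldsymbol{\mu})\times\nabla G(\boldsymbol{\mu}))$. The map $\mathbf{J}_{1:1}\colon\mathbb{C}_\times^2\to\mathfrak{su}(2)^*$ is $$\mathbf{J}_{1:1}(\mathbf{b})=i\left(\mathbf{b}\mathbf{b}^*-\tfrac12|\mathbf{b}|^2I\right)=\left(\operatorname{Re}(b_1\bar b_2),\operatorname{Im}(b_1\bar b_2),\tfrac12(|b_1|^2-|b_2|^2)\right)$$ (it is the momentum map for the natural $\mathsf{SU}(2)$-action), and $\mathbf{J}_{n:m}:=\mathbf{J}_{1:1}\circ f_{n:m}$. *)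

theory Defs
  imports "HOL-Analysis.Analysis"
begin

unbundle no cross3_syntax

section \<open>Smooth maps and tangent maps\<close>

text \<open>
  All manifolds involved are open subsets of Euclidean spaces, so that every tangent space is the
  ambient space and the tangent map at a point is the Frechet derivative.
  A map is of class \<open>C^(k+1)\<close> on an open set iff it is differentiable there and all its
  directional derivatives are of class \<open>C^k\<close>.
\<close>

primrec Ck_on :: "nat \<Rightarrow> 'a::euclidean_space set \<Rightarrow> ('a \<Rightarrow> 'b::euclidean_space) \<Rightarrow> bool" where
  "Ck_on 0 U f \<longleftrightarrow> continuous_on U f"
| "Ck_on (Suc k) U f \<longleftrightarrow>
     (\<forall>x\<in>U. f differentiable (at x)) \<and>
     (\<forall>v. Ck_on k U (\<lambda>x. frechet_derivative f (at x) v))"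

definition smooth_on :: "'a::euclidean_space set \<Rightarrow> ('a \<Rightarrow> 'b::euclidean_space) \<Rightarrow> bool" where
  "smooth_on U f \<longleftrightarrow> open U \<and> (\<forall>k. Ck_on k U f)"

definition ker_T :: "('a::euclidean_space \<Rightarrow> 'b::euclidean_space) \<Rightarrow> 'a \<Rightarrow> 'a set" where
  "ker_T \<phi> a = {v. frechet_derivative \<phi> (at a) v = 0}"

section \<open>Poisson maps\<close>

text \<open>
  A bracket maps a pair of real functions to a real function; it is only ever applied to functions
  that are smooth on the open set carrying the Poisson structure.
\<close>

type_synonym 'a bracket = "('a \<Rightarrow> real) \<Rightarrow> ('a \<Rightarrow> real) \<Rightarrow> 'a \<Rightarrow> real"

definition poisson_map ::
  "'a::euclidean_space set \<Rightarrow> 'a bracket \<Rightarrow> 'b::euclidean_space set \<Rightarrow> 'b bracket \<Rightarrow> ('a \<Rightarrow> 'b) \<Rightarrow> bool"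
  where
  "poisson_map U br V br' \<phi> \<longleftrightarrow>
     smooth_on U \<phi> \<and> \<phi> ` U \<subseteq> V \<and>
     (\<forall>F G. smooth_on V F \<longrightarrow> smooth_on V G \<longrightarrow>
        (\<forall>x\<in>U. br (F \<circ> \<phi>) (G \<circ> \<phi>) x = br' F G (\<phi> x)))"

definition zero_bracket :: "real bracket" where
  "zero_bracket F G x = 0"

section \<open>The symplectic manifold of pairs of nonzero complex numbers\<close>

definition Cx2 :: "(complex \<times> complex) set" where
  "Cx2 = {a. fst a \<noteq> 0 \<and> snd a \<noteq> 0}"

text \<open>The value of \<open>da \<and> d(cnj a)\<close> on a pair of tangent vectors of the complex plane.\<close>

definition da_wedge_dabar :: "complex \<Rightarrow> complex \<Rightarrow> complex" where
  "da_wedge_dabar u v = u * cnj v - v * cnj u"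

definition Omega :: "complex \<times> complex \<Rightarrow> complex \<times> complex \<Rightarrow> real" where
  "Omega u v =
     Re (- (\<i> / 2) * (da_wedge_dabar (fst u) (fst v) + da_wedge_dabar (snd u) (snd v)))"

lemma of_real_Omega:
  "of_real (Omega u v) =
     - (\<i> / 2) * (da_wedge_dabar (fst u) (fst v) + da_wedge_dabar (snd u) (snd v))"
  by (simp add: Omega_def da_wedge_dabar_def complex_eq_iff)

definition symplectic_orth :: "(complex \<times> complex) set \<Rightarrow> (complex \<times> complex) set" where
  "symplectic_orth W = {v. \<forall>w\<in>W. Omega v w = 0}"

text \<open>
  Wirtinger derivatives of a real function: if \<open>d\<close> denotes the real derivative in a direction
  \<open>e\<close> and \<open>d'\<close> the one in the direction \<open>\<i> e\<close>, they are \<open>(d - \<i> d') / 2\<close> and \<open>(d + \<i> d') / 2\<close>.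
\<close>

definition wirt :: "(complex \<times> complex \<Rightarrow> real) \<Rightarrow> complex \<times> complex \<Rightarrow> complex \<times> complex
    \<Rightarrow> complex \<times> complex \<Rightarrow> complex" where
  "wirt F e e' a =
     (of_real (frechet_derivative F (at a) e) - \<i> * of_real (frechet_derivative F (at a) e')) / 2"

definition wirt_bar :: "(complex \<times> complex \<Rightarrow> real) \<Rightarrow> complex \<times> complex \<Rightarrow> complex \<times> complex
    \<Rightarrow> complex \<times> complex \<Rightarrow> complex" where
  "wirt_bar F e e' a =
     (of_real (frechet_derivative F (at a) e) + \<i> * of_real (frechet_derivative F (at a) e')) / 2"

abbreviation "d_a1 F \<equiv> wirt F (1, 0) (\<i>, 0)"
abbreviation "d_a2 F \<equiv> wirt F (0, 1) (0, \<i>)"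
abbreviation "d_a1bar F \<equiv> wirt_bar F (1, 0) (\<i>, 0)"
abbreviation "d_a2bar F \<equiv> wirt_bar F (0, 1) (0, \<i>)"

definition bracket_C2 :: "(complex \<times> complex) bracket" where
  "bracket_C2 F G a =
     Re (2 * \<i> * ((d_a1 F a * d_a1bar G a - d_a1 G a * d_a1bar F a) +
                  (d_a2 F a * d_a2bar G a - d_a2 G a * d_a2bar F a)))"

lemma of_real_bracket_C2:
  "of_real (bracket_C2 F G a) =
     2 * \<i> * ((d_a1 F a * d_a1bar G a - d_a1 G a * d_a1bar F a) +
              (d_a2 F a * d_a2bar G a - d_a2 G a * d_a2bar F a))"
  by (simp add: bracket_C2_def wirt_def wirt_bar_def complex_eq_iff mult.commute)

section \<open>The Lie algebra su(2) and the Lie--Poisson bracket on its dual\<close>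

definition mat2 :: "complex \<Rightarrow> complex \<Rightarrow> complex \<Rightarrow> complex \<Rightarrow> complex ^ 2 ^ 2" where
  "mat2 a b c d = vector [vector [a, b], vector [c, d]]"

definition mat_adjoint :: "complex ^ 2 ^ 2 \<Rightarrow> complex ^ 2 ^ 2" where
  "mat_adjoint A = (\<chi> i j. cnj (A $ j $ i))"

definition su2 :: "(complex ^ 2 ^ 2) set" where
  "su2 = {A. mat_adjoint A = - A \<and> trace A = 0}"

text \<open>
  The identification of \<open>su(2)\<close> with real 3-space.  Its dual is identified with \<open>su(2)\<close>, hence also
  with real 3-space, through the inner product \<open>su2_inner\<close>; the lemmas below show that this is the
  Euclidean dot product.
\<close>

definition su2_of :: "real ^ 3 \<Rightarrow> complex ^ 2 ^ 2" where
  "su2_of x =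
     mat2 (\<i> * of_real (x $ 3)) (\<i> * (of_real (x $ 1) + \<i> * of_real (x $ 2)))
          (\<i> * (of_real (x $ 1) - \<i> * of_real (x $ 2))) (\<i> * - of_real (x $ 3))"

definition su2_inner :: "complex ^ 2 ^ 2 \<Rightarrow> complex ^ 2 ^ 2 \<Rightarrow> real" where
  "su2_inner A B = Re (trace (mat_adjoint A ** B) / 2)"

definition lie_bracket :: "complex ^ 2 ^ 2 \<Rightarrow> complex ^ 2 ^ 2 \<Rightarrow> complex ^ 2 ^ 2" where
  "lie_bracket A B = A ** B - B ** A"

definition grad :: "(real ^ 3 \<Rightarrow> real) \<Rightarrow> real ^ 3 \<Rightarrow> real ^ 3" where
  "grad F x = (\<chi> i. frechet_derivative F (at x) (axis i 1))"

definition lie_poisson_plus :: "(real ^ 3) bracket" where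
  "lie_poisson_plus F G x =
     su2_inner (su2_of x) (lie_bracket (su2_of (grad F x)) (su2_of (grad G x)))"

lemmas su2_simps =
  su2_of_def mat2_def mat_adjoint_def trace_def matrix_matrix_mult_def sum_2 vec_eq_iff
  forall_2 forall_3 complex_eq_iff

lemma bij_betw_su2_of: "bij_betw su2_of UNIV su2"
proof (rule bij_betwI')
  show "su2_of x = su2_of y \<longleftrightarrow> x = y" for x y
    by (auto simp: su2_simps)
  show "su2_of x \<in> su2" for x
    by (simp add: su2_def su2_simps)
  show "\<exists>x\<in>UNIV. A = su2_of x" if "A \<in> su2" for A
  proof
    have adj: "cnj (A $ j $ i) = - A $ i $ j" for i j
      using that by (simp add: su2_def mat_adjoint_def vec_eq_iff)
    have tr: "A $ 1 $ 1 + A $ 2 $ 2 = 0"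
      using that by (simp add: su2_def trace_def sum_2)
    have "Re (A $ 1 $ 1) = 0" "Re (A $ 2 $ 2) = 0"
         "Re (A $ 2 $ 1) = - Re (A $ 1 $ 2)" "Im (A $ 2 $ 1) = Im (A $ 1 $ 2)"
      using adj[of 1 1] adj[of 2 2] adj[of 2 1] by (simp_all add: complex_eq_iff)
    moreover have "Im (A $ 2 $ 2) = - Im (A $ 1 $ 1)"
      using tr by (simp add: complex_eq_iff)
    ultimately show "A = su2_of (vector [Im (A $ 1 $ 2), - Re (A $ 1 $ 2), Im (A $ 1 $ 1)])"
      by (simp add: su2_simps)
  qed simp
qed

lemma su2_inner_su2_of: "su2_inner (su2_of x) (su2_of y) = x \<bullet> y"
  by (simp add: su2_inner_def su2_simps inner_vec_def sum_3 field_simps)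

lemma lie_bracket_su2_of: "lie_bracket (su2_of x) (su2_of y) = su2_of (2 *\<^sub>R cross3 x y)"
  by (simp add: lie_bracket_def su2_simps cross3_def algebra_simps)

lemma lie_poisson_plus_eq: "lie_poisson_plus F G x = 2 * (x \<bullet> cross3 (grad F x) (grad G x))"
  by (simp add: lie_poisson_plus_def lie_bracket_su2_of su2_inner_su2_of)

section \<open>The maps of the dual pair\<close>

definition f_res :: "nat \<Rightarrow> nat \<Rightarrow> complex \<times> complex \<Rightarrow> complex \<times> complex" where
  "f_res n m a =
     (fst a ^ m / of_real (sqrt (real m) * norm (fst a) ^ (m - 1)),
      snd a ^ n / of_real (sqrt (real n) * norm (snd a) ^ (n - 1)))"

lemma f_res_in_Cx2: "n > 0 \<Longrightarrow> m > 0 \<Longrightarrow> a \<in> Cx2 \<Longrightarrow> f_res n m a \<in> Cx2"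
  by (simp add: f_res_def Cx2_def)

definition R_res :: "nat \<Rightarrow> nat \<Rightarrow> complex \<times> complex \<Rightarrow> real" where
  "R_res n m a = 1 / 2 * ((norm (fst a))\<^sup>2 / real m + (norm (snd a))\<^sup>2 / real n)"

definition J_11 :: "complex \<times> complex \<Rightarrow> real ^ 3" where
  "J_11 b = vector [Re (fst b * cnj (snd b)), Im (fst b * cnj (snd b)),
                    1 / 2 * ((norm (fst b))\<^sup>2 - (norm (snd b))\<^sup>2)]"

lemma su2_of_J_11:
  fixes b1 b2 :: complex
  defines "b \<equiv> (vector [b1, b2] :: complex ^ 2)"
  shows "su2_of (J_11 (b1, b2)) =
           (\<chi> i j. \<i> * (b $ i * cnj (b $ j) - 1 / 2 * of_real ((norm b)\<^sup>2) * mat 1 $ i $ j))"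
proof -
  have "(norm b)\<^sup>2 = (norm b1)\<^sup>2 + (norm b2)\<^sup>2"
    by (simp add: b_def norm_vec_def L2_set_def sum_2)
  moreover have "b $ 1 = b1" "b $ 2 = b2"
    by (simp_all add: b_def)
  ultimately show ?thesis
    unfolding J_11_def su2_simps mat_def
    by (simp add: cmod_power2) (simp add: power2_eq_square field_simps)
qed

definition J_res :: "nat \<Rightarrow> nat \<Rightarrow> complex \<times> complex \<Rightarrow> real ^ 3" where
  "J_res n m = J_11 \<circ> f_res n m"

lemma J_res_1_1: "J_res 1 1 = J_11"
  by (simp add: J_res_def f_res_def fun_eq_iff)

section \<open>Dual pairs\<close>

definition dual_pair ::
  "(complex \<times> complex) set \<Rightarrow> (complex \<times> complex \<Rightarrow> 'b::euclidean_space)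
    \<Rightarrow> (complex \<times> complex \<Rightarrow> 'c::euclidean_space) \<Rightarrow> bool" where
  "dual_pair U \<phi> \<psi> \<longleftrightarrow>
     (\<forall>a\<in>U. ker_T \<phi> a = symplectic_orth (ker_T \<psi> a) \<and>
            ker_T \<psi> a = symplectic_orth (ker_T \<phi> a))"

end

theory Submission
  imports Defs
begin

text \<open>
  In polar coordinates \<open>a = r e^(i \<theta>)\<close> each factor of \<open>f_res n m\<close> sends \<open>(r\<^sup>2 / 2, \<theta>)\<close> to
  \<open>(r\<^sup>2 / 2m, m \<theta>)\<close> (with \<open>n\<close> in place of \<open>m\<close> in the second factor).  Since \<open>r\<^sup>2 / 2\<close> and \<open>\<theta>\<close>
  are action-angle coordinates of the plane, the action shrinks by exactly the factor by which the
  angle is stretched, so every tangent map of \<open>f_res n m\<close> is symplectic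
  (\<open>res_pow_area_preserving\<close>, \<open>symplectic_f_res\<close>).

  Two general principles then reduce everything to the case \<open>1:1\<close>.  A map with symplectic tangent
  maps is Poisson (\<open>symplectic_poisson_map\<close>), and Poisson maps compose.  Moreover kernels of
  composites are preimages of kernels, and taking preimages under a symplectic linear isomorphism
  commutes with taking symplectic complements, so dual pairs pull back
  (\<open>dual_pair_symplectic_pullback\<close>).  As \<open>J_res n m\<close> is by definition, and \<open>R_res n m\<close> by a short
  computation, a composite with \<open>f_res n m\<close>, it remains to treat \<open>R_res 1 1\<close> and \<open>J_11\<close>.

  There, the kernel of the tangent map of \<open>J_11\<close> at \<open>b\<close> is the line through \<open>\<i> b\<close>, the direction of
  the diagonal phase rotation, and the kernel of that of \<open>R_res 1 1\<close> is the Euclidean complement of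
  \<open>b\<close>.  Pairing with \<open>\<i> b\<close> under \<open>Omega\<close> is the Euclidean pairing with \<open>b\<close>; hence the two kernels are
  symplectic complements (\<open>dual_pair_11\<close>).  That \<open>J_11\<close> is Poisson is a polynomial identity between
  the brackets of its components (\<open>bracket_dJ_11\<close>), and any smooth real function is a Poisson map to
  the real line with zero bracket, because all functions that factor through it have proportional
  differentials.

  Smoothness is proved by a calculus of \<open>Ck_on\<close>: sums, bilinear products and composites of smooth
  maps are smooth, and so is \<open>1 / |x|\<close> away from the origin.
\<close>


section \<open>Calculus of smooth maps\<close>

lemma frechet_derivative_eqI: "(f has_derivative f') (at x) \<Longrightarrow> frechet_derivative f (at x) = f'"
  by (metis frechet_derivative_at)

lemma frechet_derivative_cong_open:
  assumes "open U" "x \<in> U" "\<And>y. y \<in> U \<Longrightarrow> f y = g y"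
  shows "frechet_derivative f (at x) = frechet_derivative g (at x)"
proof -
  have "(f has_derivative D) (at x) \<longleftrightarrow> (g has_derivative D) (at x)" for D
    using assms has_derivative_transform_within_open[of _ D x UNIV U] by metis
  then show ?thesis
    unfolding frechet_derivative_def by simp
qed

text \<open>
  The class is a local notion: on an open set, the iterated derivatives only depend on the values of
  the map there.
\<close>

lemma Ck_on_cong:
  assumes "open U" "\<And>y. y \<in> U \<Longrightarrow> f y = g y" "Ck_on k U f"
  shows "Ck_on k U g"
  using assms(2,3)
proof (induction k arbitrary: f g)
  case 0
  then show ?case by (simp cong: continuous_on_cong)
next
  case (Suc k)
  have "g differentiable (at x)" if "x \<in> U" for x
    using Suc.prems that assms(1) has_derivative_transform_within_open[of f _ x UNIV U g]
    unfolding Ck_on.simps differentiable_def by metis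
  moreover have "Ck_on k U (\<lambda>x. frechet_derivative g (at x) v)" for v
    by (rule Suc.IH[of "\<lambda>x. frechet_derivative f (at x) v"])
      (use Suc.prems in \<open>auto intro!: fun_cong[OF frechet_derivative_cong_open[OF assms(1)]]\<close>)
  ultimately show ?case by simp
qed

text \<open>
  The working introduction rule: it trades the Frechet derivative, a choice operator, for an explicit
  formula.
\<close>

lemma Ck_on_SucI:
  assumes "open U" "\<And>x. x \<in> U \<Longrightarrow> (f has_derivative f' x) (at x)" "\<And>v. Ck_on k U (\<lambda>x. f' x v)"
  shows "Ck_on (Suc k) U f"
proof -
  have "Ck_on k U (\<lambda>x. frechet_derivative f (at x) v)" for v
    by (rule Ck_on_cong[OF assms(1) _ assms(3)[of v]])
      (simp add: frechet_derivative_eqI[OF assms(2)])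
  then show ?thesis
    using assms(2) by (auto simp: differentiable_def)
qed

lemma Ck_on_SucD:
  assumes "Ck_on (Suc k) U f" "x \<in> U"
  shows "(f has_derivative frechet_derivative f (at x)) (at x)"
  using assms frechet_derivative_works by auto

lemma Ck_on_decrease: "Ck_on (Suc k) U f \<Longrightarrow> Ck_on k U f"
proof (induction k arbitrary: f)
  case 0
  then show ?case
    by (auto intro!: differentiable_imp_continuous_on
        simp: differentiable_on_def differentiable_at_withinI)
qed auto

lemma Ck_on_const: "open U \<Longrightarrow> Ck_on k U (\<lambda>_. c)"
proof (induction k arbitrary: c)
  case (Suc k)
  show ?case
    by (rule Ck_on_SucI[where f' = "\<lambda>_ _. 0"]) (use Suc in auto)
qed auto

lemma Ck_on_bounded_linear:
  assumes "open U" "bounded_linear h" "Ck_on k U f"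
  shows "Ck_on k U (\<lambda>x. h (f x))"
  using assms(3)
proof (induction k arbitrary: f)
  case 0
  then show ?case using bounded_linear.continuous_on[OF assms(2)] by auto
next
  case (Suc k)
  show ?case
    by (rule Ck_on_SucI[OF assms(1), where f' = "\<lambda>x v. h (frechet_derivative f (at x) v)"])
      (use Suc.prems in \<open>auto intro!: bounded_linear.has_derivative[OF assms(2)] Suc.IH
        simp: frechet_derivative_works[symmetric]\<close>)
qed

lemma Ck_on_ident: "open U \<Longrightarrow> Ck_on k U (\<lambda>x. x)"
proof (cases k)
  case (Suc k)
  assume U: "open U"
  show ?thesis unfolding Suc
    by (rule Ck_on_SucI[where f' = "\<lambda>_ v. v"]) (use U in \<open>auto intro: Ck_on_const has_derivative_ident\<close>)
qed auto

lemma Ck_on_add: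
  assumes "open U" "Ck_on k U f" "Ck_on k U g"
  shows "Ck_on k U (\<lambda>x. f x + g x)"
  using assms(2,3)
proof (induction k arbitrary: f g)
  case (Suc k)
  show ?case
    by (rule Ck_on_SucI[OF assms(1), where
          f' = "\<lambda>x v. frechet_derivative f (at x) v + frechet_derivative g (at x) v"])
      (use Suc.prems in \<open>auto intro!: has_derivative_add Suc.IH
        simp: frechet_derivative_works[symmetric]\<close>)
qed (auto intro: continuous_on_add)

text \<open>
  The Leibniz rule writes the derivative as a sum of two products of the same shape, whose factors
  are among the maps and their derivatives.  Thus all derivatives are covered by one induction that
  leaves the two maps arbitrary.
\<close>

lemma Ck_on_bilinear:
  assumes "open U" "bounded_bilinear p" "Ck_on k U f" "Ck_on k U g"
  shows "Ck_on k U (\<lambda>x. p (f x) (g x))"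
  using assms(3,4)
proof (induction k arbitrary: f g)
  case 0
  then show ?case using bounded_bilinear.continuous_on[OF assms(2)] by auto
next
  case (Suc k)
  show ?case
  proof (rule Ck_on_SucI[OF assms(1), where
        f' = "\<lambda>x v. p (f x) (frechet_derivative g (at x) v) + p (frechet_derivative f (at x) v) (g x)"])
    show "Ck_on k U (\<lambda>x. p (f x) (frechet_derivative g (at x) v)
        + p (frechet_derivative f (at x) v) (g x))" for v
      using Suc.prems Ck_on_decrease[OF Suc.prems(1)] Ck_on_decrease[OF Suc.prems(2)]
      by (intro Ck_on_add[OF assms(1)] Suc.IH) auto
  qed (intro bounded_bilinear.FDERIV[OF assms(2)] Ck_on_SucD[OF Suc.prems(1)] Ck_on_SucD[OF Suc.prems(2)])
qed

lemma Ck_on_power: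
  fixes f :: "'a::euclidean_space \<Rightarrow> 'b::{euclidean_space, real_normed_algebra_1}"
  assumes "open U" "Ck_on k U f"
  shows "Ck_on k U (\<lambda>x. f x ^ j)"
  by (induction j) (auto intro: Ck_on_bilinear[OF _ bounded_bilinear_mult] Ck_on_const assms)

lemma Ck_on_sum:
  assumes "open U" "finite I" "\<And>i. i \<in> I \<Longrightarrow> Ck_on k U (f i)"
  shows "Ck_on k U (\<lambda>x. \<Sum>i\<in>I. f i x)"
  using assms(2,3)
  by (induction I) (auto intro: Ck_on_const Ck_on_add assms(1))

text \<open>
  The chain rule, expanded in a basis so that the derivative of the outer map occurs only in fixed
  directions, expresses the derivative of the composite by products of derivatives of the inner map
  with composites of one class lower.
\<close>

lemma Ck_on_compose:
  assumes "open U" "Ck_on k U f" "Ck_on k V g" "f ` U \<subseteq> V"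
  shows "Ck_on k U (\<lambda>x. g (f x))"
  using assms(2,3)
proof (induction k arbitrary: g)
  case 0
  then show ?case using assms(4) continuous_on_compose2[of V g U f] by auto
next
  case (Suc k)
  let ?Df = "\<lambda>x. frechet_derivative f (at x)" and ?Dg = "\<lambda>y. frechet_derivative g (at y)"
  show ?case
  proof (rule Ck_on_SucI[OF assms(1), where
        f' = "\<lambda>x v. \<Sum>b\<in>Basis. (?Df x v \<bullet> b) *\<^sub>R ?Dg (f x) b"])
    fix x assume x: "x \<in> U"
    have g: "(g has_derivative ?Dg (f x)) (at (f x))"
      using x assms(4) by (intro Ck_on_SucD[OF Suc.prems(2)]) auto
    have "(\<Sum>b\<in>Basis. (w \<bullet> b) *\<^sub>R ?Dg (f x) b) = ?Dg (f x) w" for w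
    proof -
      have "?Dg (f x) (\<Sum>b\<in>Basis. (w \<bullet> b) *\<^sub>R b) = (\<Sum>b\<in>Basis. (w \<bullet> b) *\<^sub>R ?Dg (f x) b)"
        using has_derivative_linear[OF g] by (simp add: linear_sum linear_cmul)
      then show ?thesis by (simp add: euclidean_representation)
    qed
    then show "((\<lambda>x. g (f x)) has_derivative (\<lambda>v. \<Sum>b\<in>Basis. (?Df x v \<bullet> b) *\<^sub>R ?Dg (f x) b)) (at x)"
      using has_derivative_compose[OF Ck_on_SucD[OF Suc.prems(1) x] g] by simp
  next
    fix v
    show "Ck_on k U (\<lambda>x. \<Sum>b\<in>Basis. (?Df x v \<bullet> b) *\<^sub>R ?Dg (f x) b)"
      using Suc.prems Ck_on_decrease[OF Suc.prems(1)]
      by (intro Ck_on_sum Ck_on_bilinear[OF _ bounded_bilinear_scaleR] Suc.IH assms(1) finite_Basis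
          Ck_on_bounded_linear[OF _ bounded_linear_inner_left]) auto
  qed
qed

lemma smooth_on_has_derivative:
  assumes "smooth_on U f" "x \<in> U"
  shows "(f has_derivative frechet_derivative f (at x)) (at x)"
  using assms Ck_on_SucD unfolding smooth_on_def by blast

lemma smooth_on_compose:
  "smooth_on U f \<Longrightarrow> smooth_on V g \<Longrightarrow> f ` U \<subseteq> V \<Longrightarrow> smooth_on U (g \<circ> f)"
  unfolding smooth_on_def comp_def using Ck_on_compose by blast

lemma smooth_on_ident: "open U \<Longrightarrow> smooth_on U (\<lambda>x. x)"
  by (simp add: smooth_on_def Ck_on_ident)

lemma smooth_on_add: "smooth_on U f \<Longrightarrow> smooth_on U g \<Longrightarrow> smooth_on U (\<lambda>x. f x + g x)"
  by (simp add: smooth_on_def Ck_on_add)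

lemma smooth_on_bounded_linear:
  "bounded_linear h \<Longrightarrow> smooth_on U f \<Longrightarrow> smooth_on U (\<lambda>x. h (f x))"
  by (simp add: smooth_on_def Ck_on_bounded_linear)

lemma smooth_on_bilinear:
  "bounded_bilinear p \<Longrightarrow> smooth_on U f \<Longrightarrow> smooth_on U g \<Longrightarrow> smooth_on U (\<lambda>x. p (f x) (g x))"
  by (simp add: smooth_on_def Ck_on_bilinear)

lemmas smooth_on_mult = smooth_on_bilinear[OF bounded_bilinear_mult]
lemmas smooth_on_inner = smooth_on_bilinear[OF bounded_bilinear_inner]

lemma smooth_on_power: "smooth_on U f \<Longrightarrow> smooth_on U (\<lambda>x. f x ^ k)"
  for f :: "'a::euclidean_space \<Rightarrow> 'b::{euclidean_space, real_normed_algebra_1}"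
  by (simp add: smooth_on_def Ck_on_power)

lemma smooth_on_Pair:
  assumes "smooth_on U f" "smooth_on U g"
  shows "smooth_on U (\<lambda>x. (f x, g x))"
proof -
  have "smooth_on U (\<lambda>x. (f x, 0) + (0, g x))"
    by (intro smooth_on_add smooth_on_bounded_linear[of "\<lambda>y. (y, 0)"]
        smooth_on_bounded_linear[of "\<lambda>y. (0, y)"] bounded_linear_Pair
        bounded_linear_ident bounded_linear_zero assms)
  then show ?thesis by simp
qed

lemma smooth_on_fst: "smooth_on U f \<Longrightarrow> smooth_on U (\<lambda>x. fst (f x))"
  by (rule smooth_on_bounded_linear[OF bounded_linear_fst])

lemma smooth_on_snd: "smooth_on U f \<Longrightarrow> smooth_on U (\<lambda>x. snd (f x))"
  by (rule smooth_on_bounded_linear[OF bounded_linear_snd])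

lemma has_derivative_inverse_norm:
  fixes x :: "'a::euclidean_space"
  assumes "x \<noteq> 0"
  shows "((\<lambda>x. inverse (norm x)) has_derivative (\<lambda>v. - (x \<bullet> v) * inverse (norm x) ^ 3)) (at x)"
proof -
  have "((\<lambda>x. inverse (norm x)) has_derivative
      (\<lambda>v. - (inverse (norm x) * (v \<bullet> sgn x) * inverse (norm x)))) (at x)"
    by (rule Deriv.has_derivative_inverse[OF _ has_derivative_norm[OF assms]]) (use assms in auto)
  then show ?thesis
    by (simp add: sgn_div_norm power3_eq_cube inner_commute mult_ac)
qed

text \<open>
  The derivative of \<open>1 / |x|\<close> is a polynomial in \<open>x\<close> and in \<open>1 / |x|\<close> itself, so membership in each
  class implies membership in the next.  This provides the only source of negative powers of the
  modulus that the resonance map involves.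
\<close>

lemma smooth_on_inverse_norm: "smooth_on (- {0 :: 'a::euclidean_space}) (\<lambda>x. inverse (norm x))"
proof -
  let ?U = "- {0 :: 'a}"
  have U: "open ?U" by auto
  have "Ck_on k ?U (\<lambda>x. inverse (norm x))" for k
  proof (induction k)
    case 0
    then show ?case by (auto intro!: continuous_on_inverse continuous_on_norm_id)
  next
    case (Suc k)
    have "Ck_on k ?U (\<lambda>x. - (x \<bullet> v) * inverse (norm x) ^ 3)" for v
      by (intro Ck_on_bilinear[OF _ bounded_bilinear_mult] Ck_on_power Suc.IH U
          Ck_on_bounded_linear[OF _ bounded_linear_minus[OF bounded_linear_inner_left]] Ck_on_ident)
    then show ?case
      by (intro Ck_on_SucI[OF U, where f' = "\<lambda>x v. - (x \<bullet> v) * inverse (norm x) ^ 3"]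
          has_derivative_inverse_norm) auto
  qed
  then show ?thesis using U by (simp add: smooth_on_def)
qed

section \<open>Symplectic linear algebra and Poisson maps\<close>

lemma poisson_map_compose:
  assumes "poisson_map U br V br' f" "poisson_map V br' W br'' g"
  shows "poisson_map U br W br'' (g \<circ> f)"
proof -
  have sm: "smooth_on U f" "smooth_on V g" "f ` U \<subseteq> V" "g ` V \<subseteq> W"
    using assms by (auto simp: poisson_map_def)
  have "br (F \<circ> (g \<circ> f)) (G \<circ> (g \<circ> f)) x = br'' F G ((g \<circ> f) x)"
    if "smooth_on W F" "smooth_on W G" "x \<in> U" for F G x
  proof -
    have "smooth_on V (F \<circ> g)" "smooth_on V (G \<circ> g)" "f x \<in> V"
      using that sm smooth_on_compose by blast+
    then show ?thesis
      using assms that by (simp add: poisson_map_def flip: comp_assoc)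
  qed
  then show ?thesis
    using sm smooth_on_compose[OF sm(1,2,3)] by (auto simp: poisson_map_def image_subset_iff)
qed

lemma Omega_eq: "Omega u v = Im (fst u * cnj (fst v)) + Im (snd u * cnj (snd v))"
  by (simp add: Omega_def da_wedge_dabar_def) (simp add: field_simps)

lemma Omega_eq_inner: "Omega u v = (- \<i> * fst u, - \<i> * snd u) \<bullet> v"
  by (simp add: Omega_eq inner_prod_def inner_complex_def)

lemma Omega_nondegenerate:
  assumes "\<And>v. Omega u v = 0"
  shows "u = 0"
proof -
  \<comment> \<open>The form is the Euclidean inner product after rotating the first argument by \<open>- \<i>\<close>.\<close>
  have "(- \<i> * fst u, - \<i> * snd u) = 0"
    using assms inner_eq_zero_iff unfolding Omega_eq_inner by blast
  then show ?thesis by (simp add: zero_prod_def prod_eq_iff)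
qed

text \<open>
  The vector that represents the functional \<open>\<alpha>\<close> through \<open>Omega\<close>, in the first slot.
\<close>

definition hamiltonian_vector :: "(complex \<times> complex \<Rightarrow> real) \<Rightarrow> complex \<times> complex" where
  "hamiltonian_vector \<alpha> = (Complex (- \<alpha> (\<i>, 0)) (\<alpha> (1, 0)), Complex (- \<alpha> (0, \<i>)) (\<alpha> (0, 1)))"

lemma Omega_hamiltonian:
  assumes "linear \<alpha>"
  shows "Omega (hamiltonian_vector \<alpha>) v = \<alpha> v"
proof -
  have v: "Re (fst v) *\<^sub>R (1, 0) + Im (fst v) *\<^sub>R (\<i>, 0)
      + Re (snd v) *\<^sub>R (0, 1) + Im (snd v) *\<^sub>R (0, \<i>) = v"
    by (simp add: prod_eq_iff complex_eq_iff)
  have "\<alpha> (Re (fst v) *\<^sub>R (1, 0) + Im (fst v) *\<^sub>R (\<i>, 0)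
      + Re (snd v) *\<^sub>R (0, 1) + Im (snd v) *\<^sub>R (0, \<i>)) = Omega (hamiltonian_vector \<alpha>) v"
    unfolding linear_add[OF assms] linear_cmul[OF assms] by (simp add: Omega_eq hamiltonian_vector_def)
  then show ?thesis
    unfolding v by simp
qed

text \<open>
  The coordinate-free form of the bracket: once Wirtinger derivatives are replaced by Hamiltonian
  vectors, it visibly depends on the symplectic form alone.
\<close>

lemma bracket_C2_hamiltonian:
  assumes "(F has_derivative \<alpha>) (at a)" "(G has_derivative \<beta>) (at a)"
  shows "bracket_C2 F G a = Omega (hamiltonian_vector \<alpha>) (hamiltonian_vector \<beta>)"
  by (simp add: bracket_C2_def wirt_def wirt_bar_def frechet_derivative_eqI[OF assms(1)]
      frechet_derivative_eqI[OF assms(2)] Omega_eq hamiltonian_vector_def) (simp add: field_simps)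

definition symplectic_linear :: "(complex \<times> complex \<Rightarrow> complex \<times> complex) \<Rightarrow> bool" where
  "symplectic_linear L \<longleftrightarrow> linear L \<and> (\<forall>u v. Omega (L u) (L v) = Omega u v)"

text \<open>
  A symplectic endomorphism is injective as the form is nondegenerate, hence onto because the
  dimension is finite.
\<close>

lemma symplectic_linear_surj:
  assumes "symplectic_linear L"
  shows "surj L"
proof -
  have lin: "linear L" and L: "\<And>u v. Omega (L u) (L v) = Omega u v"
    using assms by (auto simp: symplectic_linear_def)
  have "u = 0" if "L u = 0" for u
  proof (rule Omega_nondegenerate)
    show "Omega u v = 0" for v
      using L[of u v] that by (simp add: Omega_eq)
  qed
  then have "inj L"
    using linear_injective_0[OF lin] by blast
  then show ?thesis
    by (rule linear_inj_imp_surj[OF lin])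
qed

text \<open>
  A symplectic isomorphism \<open>L\<close> carries the Hamiltonian vector of \<open>\<gamma> \<circ> L\<close> to that of \<open>\<gamma>\<close>, and the
  bracket is the value of the form on two Hamiltonian vectors.
\<close>

lemma symplectic_poisson_map:
  assumes "smooth_on U f" "f ` U \<subseteq> V"
    and "\<And>a. a \<in> U \<Longrightarrow> symplectic_linear (frechet_derivative f (at a))"
  shows "poisson_map U bracket_C2 V bracket_C2 f"
  unfolding poisson_map_def
proof (intro conjI allI impI ballI assms)
  fix F G :: "complex \<times> complex \<Rightarrow> real" and a
  assume F: "smooth_on V F" and G: "smooth_on V G" and a: "a \<in> U"
  define L where "L = frechet_derivative f (at a)"
  define \<alpha> \<beta> where "\<alpha> = frechet_derivative F (at (f a))" and "\<beta> = frechet_derivative G (at (f a))"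
  have L: "symplectic_linear L" and fL: "(f has_derivative L) (at a)"
    using assms(3)[OF a] smooth_on_has_derivative[OF assms(1) a] by (simp_all add: L_def)
  have "f a \<in> V" using a assms(2) by blast
  then have dF: "(F has_derivative \<alpha>) (at (f a))" and dG: "(G has_derivative \<beta>) (at (f a))"
    unfolding \<alpha>_def \<beta>_def using F G by (auto intro: smooth_on_has_derivative)
  have pull: "L (hamiltonian_vector (\<gamma> \<circ> L)) = hamiltonian_vector \<gamma>" if "linear \<gamma>" for \<gamma>
  proof -
    obtain Y where Y: "hamiltonian_vector \<gamma> = L Y"
      using symplectic_linear_surj[OF L] by blast
    have "linear (\<gamma> \<circ> L)"
      using that L by (auto simp: symplectic_linear_def intro: linear_compose)
    then have "Omega (hamiltonian_vector (\<gamma> \<circ> L)) v = Omega Y v" for v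
      using Omega_hamiltonian[OF that, of "L v"] L unfolding Y symplectic_linear_def by (metis Omega_hamiltonian comp_apply)
    then have "Omega (hamiltonian_vector (\<gamma> \<circ> L) - Y) v = 0" for v
      by (simp add: Omega_eq algebra_simps)
    then show ?thesis
      using Omega_nondegenerate Y by fastforce
  qed
  have "bracket_C2 (F \<circ> f) (G \<circ> f) a = Omega (hamiltonian_vector (\<alpha> \<circ> L)) (hamiltonian_vector (\<beta> \<circ> L))"
    by (intro bracket_C2_hamiltonian diff_chain_at fL dF dG)
  also have "\<dots> = Omega (hamiltonian_vector \<alpha>) (hamiltonian_vector \<beta>)"
    using L pull[OF has_derivative_linear[OF dF]] pull[OF has_derivative_linear[OF dG]]
    by (metis symplectic_linear_def)
  also have "\<dots> = bracket_C2 F G (f a)"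
    by (rule bracket_C2_hamiltonian[OF dF dG, symmetric])
  finally show "bracket_C2 (F \<circ> f) (G \<circ> f) a = bracket_C2 F G (f a)" .
qed

text \<open>
  As \<open>L\<close> is onto, the vectors of \<open>W\<close> are exactly the images of those of its preimage.
\<close>

lemma symplectic_orth_vimage:
  assumes "symplectic_linear L"
  shows "symplectic_orth (L -` W) = L -` symplectic_orth W"
proof -
  have "(\<forall>w\<in>L -` W. Omega v w = 0) \<longleftrightarrow> (\<forall>w\<in>W. Omega (L v) w = 0)" for v
    using assms symplectic_linear_surj[OF assms]
    by (metis (no_types, lifting) surjD symplectic_linear_def vimage_eq)
  then show ?thesis
    by (auto simp: symplectic_orth_def)
qed

lemma dual_pair_symplectic_pullback:
  assumes "smooth_on U f" "f ` U \<subseteq> V"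
    and "\<And>a. a \<in> U \<Longrightarrow> symplectic_linear (frechet_derivative f (at a))"
    and "smooth_on V \<phi>" "smooth_on V \<psi>" "dual_pair V \<phi> \<psi>"
  shows "dual_pair U (\<phi> \<circ> f) (\<psi> \<circ> f)"
  unfolding dual_pair_def
proof
  fix a assume a: "a \<in> U"
  let ?L = "frechet_derivative f (at a)"
  have fa: "f a \<in> V" using a assms(2) by blast
  have ker: "ker_T (\<kappa> \<circ> f) a = ?L -` ker_T \<kappa> (f a)" if "smooth_on V \<kappa>"
    for \<kappa> :: "complex \<times> complex \<Rightarrow> 'z::euclidean_space"
    using frechet_derivative_eqI[OF diff_chain_at[OF smooth_on_has_derivative[OF assms(1) a]
          smooth_on_has_derivative[OF that fa]]]
    by (auto simp: ker_T_def)
  show "ker_T (\<phi> \<circ> f) a = symplectic_orth (ker_T (\<psi> \<circ> f) a) \<and>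
      ker_T (\<psi> \<circ> f) a = symplectic_orth (ker_T (\<phi> \<circ> f) a)"
    unfolding ker[OF assms(4)] ker[OF assms(5)] symplectic_orth_vimage[OF assms(3)[OF a]]
    using assms(6) fa unfolding dual_pair_def by blast
qed

text \<open>
  By the chain rule the differentials of \<open>F \<circ> \<phi>\<close> and \<open>G \<circ> \<phi>\<close> are both multiples of the differential
  of \<open>\<phi>\<close>, and the bracket is alternating.
\<close>

lemma poisson_map_real:
  assumes "smooth_on U \<phi>"
  shows "poisson_map U bracket_C2 UNIV zero_bracket \<phi>"
  unfolding poisson_map_def zero_bracket_def
proof (intro conjI allI impI ballI assms)
  fix F G :: "real \<Rightarrow> real" and x
  assume F: "smooth_on UNIV F" and G: "smooth_on UNIV G" and x: "x \<in> U"
  let ?D = "frechet_derivative \<phi> (at x)"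
  have D: "(\<phi> has_derivative ?D) (at x)" by (rule smooth_on_has_derivative[OF assms x])
  have scale: "frechet_derivative H (at y) t = t * frechet_derivative H (at y) 1"
    if "smooth_on UNIV H" for H :: "real \<Rightarrow> real" and y t
    using linear_cmul[OF has_derivative_linear[OF smooth_on_has_derivative[OF that UNIV_I]], of y t 1]
    by simp
  have H: "((H \<circ> \<phi>) has_derivative (\<lambda>v. ?D v * frechet_derivative H (at (\<phi> x)) 1)) (at x)"
    if "smooth_on UNIV H" for H :: "real \<Rightarrow> real"
    using diff_chain_at[OF D smooth_on_has_derivative[OF that UNIV_I]]
    unfolding comp_def scale[OF that, of "\<phi> x" "?D _"] .
  show "bracket_C2 (F \<circ> \<phi>) (G \<circ> \<phi>) x = 0"
    unfolding bracket_C2_hamiltonian[OF H[OF F] H[OF G]] by (simp add: Omega_eq hamiltonian_vector_def)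
qed auto

section \<open>The resonance map\<close>

lemma open_Cx2: "open Cx2"
proof -
  have *: "Cx2 = (- {0}) \<times> (- {0})"
    by (auto simp: Cx2_def)
  show ?thesis
    unfolding * by (intro open_Times open_Compl closed_singleton)
qed

definition res_pow :: "nat \<Rightarrow> complex \<Rightarrow> complex" where
  "res_pow m z = z ^ m / of_real (sqrt (real m) * norm z ^ (m - 1))"

lemma f_res_eq: "f_res n m a = (res_pow m (fst a), res_pow n (snd a))"
  by (simp add: f_res_def res_pow_def)

text \<open>
  Writing the factor with the unit vector \<open>sgn z\<close> separates modulus and phase; this is the form that
  is differentiated.
\<close>

lemma res_pow_sgn:
  assumes "m > 0"
  shows "res_pow m z = of_real (1 / sqrt (real m)) * (z * sgn z ^ (m - 1))"
proof -
  obtain k where "m = Suc k" using assms gr0_implies_Suc by blast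
  then show ?thesis
    by (simp add: res_pow_def sgn_eq power_divide)
qed

lemma norm_res_pow:
  assumes "m > 0"
  shows "(norm (res_pow m z))\<^sup>2 = (norm z)\<^sup>2 / real m"
  unfolding res_pow_sgn[OF assms]
  by (cases "z = 0") (simp_all add: norm_mult norm_divide norm_power norm_sgn power_mult_distrib power_divide)

text \<open>
  Radial motion leaves \<open>sgn z\<close> fixed.  The angular part of \<open>v\<close> rotates it with angular velocity
  \<open>Im (v / z)\<close>, and the velocity of a rotating point is \<open>\<i>\<close> times the point.
\<close>

lemma has_derivative_sgn_complex:
  fixes z :: complex
  assumes "z \<noteq> 0"
  shows "(sgn has_derivative (\<lambda>v. \<i> * of_real (Im (v / z)) * sgn z)) (at z)"
proof -
  have "((\<lambda>z. inverse (norm z) *\<^sub>R z) has_derivative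
      (\<lambda>v. inverse (norm z) *\<^sub>R v + (- (z \<bullet> v) * inverse (norm z) ^ 3) *\<^sub>R z)) (at z)"
    by (intro has_derivative_scaleR has_derivative_inverse_norm assms has_derivative_ident)
  moreover have "inverse (norm z) *\<^sub>R v + (- (z \<bullet> v) * inverse (norm z) ^ 3) *\<^sub>R z
      = \<i> * of_real (Im (v / z)) * sgn z" for v
  proof -
    have "(z \<bullet> v) * inverse (norm z) ^ 2 = Re (v / z)"
      by (simp add: Re_divide' inner_complex_def cmod_def field_simps)
    then have "(- (z \<bullet> v) * inverse (norm z) ^ 3) *\<^sub>R z = - (of_real (Re (v / z)) * sgn z)"
      by (simp add: sgn_div_norm scaleR_conv_of_real power3_eq_cube power2_eq_square mult_ac)
    moreover have "inverse (norm z) *\<^sub>R v = (v / z) * sgn z"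
      using assms by (simp add: sgn_div_norm scaleR_conv_of_real)
    moreover have "v / z - of_real (Re (v / z)) = \<i> * of_real (Im (v / z))"
      by (simp add: complex_eq_iff)
    ultimately show ?thesis
      by (metis add_uminus_conv_diff left_diff_distrib)
  qed
  ultimately show ?thesis
    by (simp add: sgn_div_norm[abs_def] divide_inverse)
qed

text \<open>
  The real and imaginary parts of \<open>v / z\<close> are the radial and angular components \<open>dr / r\<close> and
  \<open>d\<theta>\<close> of \<open>v\<close>.  The logarithmic derivative of the map keeps the first and multiplies the second
  by \<open>m\<close>.
\<close>

lemma has_derivative_res_pow:
  assumes "m > 0" "z \<noteq> 0"
  shows "(res_pow m has_derivative
    (\<lambda>v. res_pow m z * Complex (Re (v / z)) (real m * Im (v / z)))) (at z)"
proof -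
  have "((\<lambda>z. z * sgn z ^ k) has_derivative
      (\<lambda>v. z * sgn z ^ k * Complex (Re (v / z)) (real (Suc k) * Im (v / z)))) (at z)" for k
  proof (induction k)
    case 0
    have "z * Complex (Re (v / z)) (Im (v / z)) = v" for v
      using assms(2) by simp
    then show ?case by simp
  next
    case (Suc k)
    have "((\<lambda>z. (z * sgn z ^ k) * sgn z) has_derivative
      (\<lambda>v. (z * sgn z ^ k) * (\<i> * of_real (Im (v / z)) * sgn z)
        + z * sgn z ^ k * Complex (Re (v / z)) (real (Suc k) * Im (v / z)) * sgn z)) (at z)"
      by (intro has_derivative_mult Suc.IH has_derivative_sgn_complex assms)
    moreover have "\<i> * of_real (Im w) + Complex (Re w) (real (Suc k) * Im w)
        = Complex (Re w) (real (Suc (Suc k)) * Im w)" for w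
      by (simp add: complex_eq_iff algebra_simps)
    then have "(z * sgn z ^ k) * (\<i> * of_real (Im w) * sgn z)
        + z * sgn z ^ k * Complex (Re w) (real (Suc k) * Im w) * sgn z
        = z * sgn z ^ Suc k * Complex (Re w) (real (Suc (Suc k)) * Im w)" for w
      by (metis (no_types, lifting) distrib_left mult.assoc mult.commute power_Suc)
    ultimately show ?case
      by (simp only: power_Suc2 mult.assoc)
  qed
  from has_derivative_mult_right[OF this[of "m - 1"], of "of_real (1 / sqrt (real m))"]
  show ?thesis
    using assms(1) by (simp add: res_pow_sgn[OF assms(1), abs_def] mult.assoc)
qed

lemma Im_mult_real_left: "Im (of_real r * w) = r * Im w"
  by simp

text \<open>
  The tangent map is division by \<open>z\<close>, then a stretch by \<open>m\<close> of the angular axis, then multiplication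
  by the value of the map, whose squared modulus is \<open>|z|\<^sup>2 / m\<close>.  The determinants
  \<open>1 / |z|\<^sup>2\<close>, \<open>m\<close> and \<open>|z|\<^sup>2 / m\<close> multiply to one.
\<close>

lemma res_pow_area_preserving:
  assumes "m > 0" "z \<noteq> 0"
  defines "L \<equiv> \<lambda>v. res_pow m z * Complex (Re (v / z)) (real m * Im (v / z))"
  shows "Im (L u * cnj (L v)) = Im (u * cnj v)"
proof -
  let ?stretch = "\<lambda>w. Complex (Re w) (real m * Im w)"
  have stretch: "Im (?stretch w * cnj (?stretch w')) = real m * Im (w * cnj w')" for w w'
    by (simp add: algebra_simps)
  have "L u * cnj (L v) = of_real ((norm (res_pow m z))\<^sup>2) * (?stretch (u / z) * cnj (?stretch (v / z)))"
    unfolding L_def complex_norm_square complex_cnj_mult by (simp only: mult_ac)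
  then have "Im (L u * cnj (L v)) = (norm z)\<^sup>2 / real m * (real m * Im (u / z * cnj (v / z)))"
    unfolding norm_res_pow[OF assms(1)] by (simp only: Im_mult_real_left stretch)
  also have "\<dots> = Im (of_real ((norm z)\<^sup>2) * (u / z * cnj (v / z)))"
    using assms(1) by (simp only: Im_mult_real_left) simp
  also have "of_real ((norm z)\<^sup>2) * (u / z * cnj (v / z)) = u * cnj v"
    unfolding complex_norm_square using assms(2) by simp
  finally show ?thesis .
qed

lemma smooth_on_res_pow:
  assumes "m > 0"
  shows "smooth_on (- {0}) (res_pow m)"
proof -
  have id: "smooth_on (- {0}) (\<lambda>z :: complex. z)"
    by (intro smooth_on_ident open_Compl) auto
  have "smooth_on (- {0}) (\<lambda>z :: complex. of_real (1 / sqrt (real m)) * (z * (inverse (norm z) *\<^sub>R z) ^ (m - 1)))"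
    by (intro smooth_on_bounded_linear[OF bounded_linear_mult_right] smooth_on_mult smooth_on_power id
        smooth_on_bilinear[OF bounded_bilinear_scaleR] smooth_on_inverse_norm)
  then show ?thesis
    by (simp add: res_pow_sgn[OF assms, abs_def] sgn_div_norm divide_inverse)
qed

lemma smooth_on_f_res:
  assumes "n > 0" "m > 0"
  shows "smooth_on Cx2 (f_res n m)"
proof -
  have "smooth_on Cx2 (res_pow m \<circ> fst)" "smooth_on Cx2 (res_pow n \<circ> snd)"
    by (rule smooth_on_compose[OF _ smooth_on_res_pow];
        use assms smooth_on_fst[OF smooth_on_ident[OF open_Cx2]]
          smooth_on_snd[OF smooth_on_ident[OF open_Cx2]] in \<open>auto simp: Cx2_def\<close>)+
  from smooth_on_Pair[OF this] show ?thesis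
    by (simp add: f_res_eq[abs_def])
qed

lemma symplectic_f_res:
  assumes "n > 0" "m > 0" "a \<in> Cx2"
  shows "symplectic_linear (frechet_derivative (f_res n m) (at a))"
proof -
  define L where "L = (\<lambda>m z v. res_pow m z * Complex (Re (v / z)) (real m * Im (v / z)))"
  have nz: "fst a \<noteq> 0" "snd a \<noteq> 0" using assms(3) by (auto simp: Cx2_def)
  have "(f_res n m has_derivative (\<lambda>v. (L m (fst a) (fst v), L n (snd a) (snd v)))) (at a)"
    unfolding f_res_eq[abs_def] L_def
    by (intro has_derivative_Pair has_derivative_compose[OF has_derivative_fst[OF has_derivative_ident]]
        has_derivative_compose[OF has_derivative_snd[OF has_derivative_ident]]
        has_derivative_res_pow assms nz)
  note D = this
  show ?thesis
    unfolding symplectic_linear_def frechet_derivative_eqI[OF D]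
  proof (intro conjI allI)
    show "linear (\<lambda>v. (L m (fst a) (fst v), L n (snd a) (snd v)))"
      by (rule has_derivative_linear[OF D])
    show "Omega (L m (fst a) (fst u), L n (snd a) (snd u)) (L m (fst a) (fst v), L n (snd a) (snd v))
        = Omega u v" for u v
      unfolding Omega_eq fst_conv snd_conv L_def
      using res_pow_area_preserving[OF assms(2) nz(1)] res_pow_area_preserving[OF assms(1) nz(2)]
      by simp
  qed
qed

lemma R_res_eq: "n > 0 \<Longrightarrow> m > 0 \<Longrightarrow> R_res n m a = (R_res 1 1 \<circ> f_res n m) a"
  by (simp add: R_res_def f_res_eq norm_res_pow)

section \<open>The dual pair for the resonance 1:1\<close>

lemma R_11_eq: "R_res 1 1 = (\<lambda>b. 1 / 2 * (b \<bullet> b))"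
  by (auto simp: R_res_def inner_prod_def power2_norm_eq_inner)

lemma smooth_on_R_11: "smooth_on Cx2 (R_res 1 1)"
  unfolding R_11_eq
  by (intro smooth_on_bounded_linear[OF bounded_linear_mult_right] smooth_on_inner
      smooth_on_ident open_Cx2)

lemma has_derivative_R_11: "(R_res 1 1 has_derivative (\<lambda>v. b \<bullet> v)) (at b)"
  unfolding R_11_eq by (auto intro!: derivative_eq_intros simp: inner_commute)

definition dJ_11 :: "complex \<times> complex \<Rightarrow> complex \<times> complex \<Rightarrow> real ^ 3" where
  "dJ_11 b v =
    (let w = fst b * cnj (snd v) + fst v * cnj (snd b)
     in vector [Re w, Im w, fst b \<bullet> fst v - snd b \<bullet> snd v])"

lemma vector_3_axis:
  "(vector [x, y, z] :: real ^ 3) = x *\<^sub>R axis 1 1 + y *\<^sub>R axis 2 1 + z *\<^sub>R axis 3 1"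
  by (simp add: vec_eq_iff forall_3 axis_def)

text \<open>
  The momentum map as a sum of products of linear maps, the form in which the rules for smoothness and
  derivatives apply.
\<close>

lemma J_11_axis:
  "J_11 = (\<lambda>b. Re (fst b * cnj (snd b)) *\<^sub>R axis 1 1 + Im (fst b * cnj (snd b)) *\<^sub>R axis 2 1
    + (1 / 2 * (fst b \<bullet> fst b + - (snd b \<bullet> snd b))) *\<^sub>R axis 3 1)"
  unfolding J_11_def vector_3_axis power2_norm_eq_inner by simp

lemma has_derivative_J_11: "(J_11 has_derivative dJ_11 b) (at b)"
  unfolding J_11_axis dJ_11_def[abs_def] Let_def vector_3_axis
  by (auto intro!: derivative_eq_intros simp: fun_eq_iff inner_commute algebra_simps)

lemma smooth_on_J_11: "smooth_on Cx2 J_11"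
  unfolding J_11_axis
  by (intro smooth_on_add smooth_on_bounded_linear[OF bounded_linear_scaleR_left]
      smooth_on_bounded_linear[OF bounded_linear_Re] smooth_on_bounded_linear[OF bounded_linear_Im]
      smooth_on_bounded_linear[OF bounded_linear_mult_right] smooth_on_mult smooth_on_inner
      smooth_on_bounded_linear[OF bounded_linear_cnj]
      smooth_on_bounded_linear[OF bounded_linear_minus[OF bounded_linear_ident]]
      smooth_on_fst smooth_on_snd smooth_on_ident open_Cx2)

lemma has_derivative_grad:
  assumes "smooth_on UNIV F"
  shows "(F has_derivative (\<lambda>w. grad F y \<bullet> w)) (at y)"
proof -
  let ?D = "frechet_derivative F (at y)"
  have D: "(F has_derivative ?D) (at y)"
    by (rule smooth_on_has_derivative[OF assms UNIV_I])
  have w: "w = (w $ 1) *\<^sub>R axis 1 1 + (w $ 2) *\<^sub>R axis 2 1 + (w $ 3) *\<^sub>R axis 3 1" for w :: "real ^ 3"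
    by (simp add: vec_eq_iff forall_3 axis_def)
  have lin: "linear ?D" by (rule has_derivative_linear[OF D])
  have "?D w = grad F y \<bullet> w" for w
  proof -
    have "?D ((w $ 1) *\<^sub>R axis 1 1 + (w $ 2) *\<^sub>R axis 2 1 + (w $ 3) *\<^sub>R axis 3 1) = grad F y \<bullet> w"
      unfolding linear_add[OF lin] linear_cmul[OF lin]
      by (simp add: grad_def inner_vec_def sum_3 mult.commute)
    then show ?thesis using w by simp
  qed
  then show ?thesis using D by presburger
qed

text \<open>
  Both sides are bilinear in \<open>p\<close> and \<open>q\<close>.  For coordinate vectors this says that the components of
  \<open>J_11\<close> satisfy the commutation relations of \<open>su(2)\<close>, that is \<open>{J1, J2} = 2 J3\<close> and its cyclic
  permutations, with the sign that the plus Lie--Poisson bracket requires.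
\<close>

lemma bracket_dJ_11:
  "Omega (hamiltonian_vector (\<lambda>v. p \<bullet> dJ_11 b v)) (hamiltonian_vector (\<lambda>v. q \<bullet> dJ_11 b v)) = 2 * (J_11 b \<bullet> cross3 p q)"
  by (simp add: Omega_eq hamiltonian_vector_def dJ_11_def J_11_def inner_vec_def sum_3 cross3_def inner_complex_def
      cmod_power2) (simp add: power2_eq_square algebra_simps)

lemma poisson_map_J_11: "poisson_map Cx2 bracket_C2 UNIV lie_poisson_plus J_11"
  unfolding poisson_map_def
proof (intro conjI allI impI ballI smooth_on_J_11)
  fix F G :: "real ^ 3 \<Rightarrow> real" and x
  assume F: "smooth_on UNIV F" and G: "smooth_on UNIV G"
  have "((H \<circ> J_11) has_derivative (\<lambda>v. grad H (J_11 x) \<bullet> dJ_11 x v)) (at x)"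
    if "smooth_on UNIV H" for H
    using diff_chain_at[OF has_derivative_J_11 has_derivative_grad[OF that]]
    by (simp add: comp_def)
  from bracket_C2_hamiltonian[OF this[OF F] this[OF G]]
  show "bracket_C2 (F \<circ> J_11) (G \<circ> J_11) x = lie_poisson_plus F G (J_11 x)"
    by (simp add: bracket_dJ_11 lie_poisson_plus_eq)
qed auto

text \<open>
  The velocity of the diagonal phase rotation \<open>b \<mapsto> e^(it) b\<close>, under which \<open>J_11\<close> is
  invariant.
\<close>

definition phase_vector :: "complex \<times> complex \<Rightarrow> complex \<times> complex" where
  "phase_vector b = (\<i> * fst b, \<i> * snd b)"

lemma ker_R_11: "ker_T (R_res 1 1) b = {v. b \<bullet> v = 0}"
  unfolding ker_T_def frechet_derivative_eqI[OF has_derivative_R_11] ..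

text \<open>
  Write the tangent vector as \<open>(b1 w1, b2 w2)\<close>.  Constancy of the first two components of \<open>J_11\<close> forces
  \<open>w1 = - cnj w2\<close>, and constancy of the third then makes both real parts vanish, which leaves
  \<open>w1 = w2\<close> purely imaginary.
\<close>

lemma ker_J_11:
  assumes "b \<in> Cx2"
  shows "ker_T J_11 b = range (\<lambda>t. t *\<^sub>R phase_vector b)"
proof -
  have nz: "fst b \<noteq> 0" "snd b \<noteq> 0" using assms by (auto simp: Cx2_def)
  have "v \<in> range (\<lambda>t. t *\<^sub>R phase_vector b)" if "dJ_11 b v = 0" for v
  proof -
    define w1 w2 where "w1 = fst v / fst b" and "w2 = snd v / snd b"
    have v: "fst v = fst b * w1" "snd v = snd b * w2"
      using nz by (simp_all add: w1_def w2_def)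
    have "fst b * cnj (snd v) + fst v * cnj (snd b) = 0" and eq: "fst b \<bullet> fst v = snd b \<bullet> snd v"
      using that by (simp_all add: dJ_11_def Let_def vec_eq_iff forall_3 complex_eq_iff)
    then have "fst b * cnj (snd b) * (w1 + cnj w2) = 0"
      by (simp add: v algebra_simps)
    then have w: "w1 = - cnj w2" using nz by (simp add: add_eq_0_iff2)
    have "fst b \<bullet> (fst b * w1) = (norm (fst b))\<^sup>2 * Re w1" "snd b \<bullet> (snd b * w2) = (norm (snd b))\<^sup>2 * Re w2"
      unfolding cmod_power2 by (simp_all add: inner_complex_def power2_eq_square algebra_simps)
    then have "((norm (fst b))\<^sup>2 + (norm (snd b))\<^sup>2) * Re w2 = 0"
      using eq by (simp add: v w algebra_simps)
    moreover have "(norm (fst b))\<^sup>2 + (norm (snd b))\<^sup>2 \<noteq> 0"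
      using nz by (simp add: sum_power2_eq_zero_iff)
    ultimately have "Re w2 = 0" by auto
    then have "v = Im w2 *\<^sub>R phase_vector b"
      by (simp add: prod_eq_iff phase_vector_def v w complex_eq_iff)
    then show ?thesis by blast
  qed
  moreover have "dJ_11 b (t *\<^sub>R phase_vector b) = 0" for t
    by (simp add: dJ_11_def Let_def phase_vector_def vec_eq_iff forall_3 inner_complex_def)
  ultimately show ?thesis
    by (auto simp: ker_T_def frechet_derivative_eqI[OF has_derivative_J_11])
qed

lemma Omega_phase_vector: "Omega v (phase_vector b) = - (b \<bullet> v)" "Omega (phase_vector b) v = b \<bullet> v"
  by (simp_all add: Omega_eq phase_vector_def inner_prod_def inner_complex_def)

lemma orth_complement_line:
  fixes b c :: "'a::real_inner"
  assumes "\<And>v. b \<bullet> v = 0 \<Longrightarrow> c \<bullet> v = 0"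
  shows "\<exists>t. c = t *\<^sub>R b"
proof
  \<comment> \<open>The component of \<open>c\<close> orthogonal to \<open>b\<close> must be orthogonal to itself; for \<open>b = 0\<close> the quotient is
    zero by convention and that component is \<open>c\<close>.\<close>
  let ?t = "(b \<bullet> c) / (b \<bullet> b)"
  have b: "b \<bullet> (c - ?t *\<^sub>R b) = 0"
    by (cases "b = 0") (simp_all add: inner_diff_right)
  then have "(c - ?t *\<^sub>R b) \<bullet> (c - ?t *\<^sub>R b) = 0"
    using assms[OF b] by (simp only: inner_diff_left inner_scaleR_left)
  then show "c = ?t *\<^sub>R b" by simp
qed

text \<open>
  By \<open>Omega_phase_vector\<close> the symplectic complement of the line through the phase vector is the Euclidean
  complement of \<open>b\<close>.  Conversely, a vector \<open>w\<close> pairs under \<open>Omega\<close> as \<open>- \<i> w\<close> does under the inner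
  product, so if it annihilates that complement then \<open>- \<i> w\<close> is a multiple of \<open>b\<close>.
\<close>

lemma dual_pair_11: "dual_pair Cx2 (R_res 1 1) J_11"
  unfolding dual_pair_def
proof
  fix b assume "b \<in> Cx2"
  note kers = ker_R_11 ker_J_11[OF this]
  have lin: "Omega v (t *\<^sub>R w) = t * Omega v w" "Omega (t *\<^sub>R v) w = t * Omega v w" for t v w
    by (simp_all add: Omega_eq algebra_simps)
  have "symplectic_orth (range (\<lambda>t. t *\<^sub>R phase_vector b)) = {v. b \<bullet> v = 0}"
    by (force simp: symplectic_orth_def lin Omega_phase_vector)
  moreover have "symplectic_orth {v. b \<bullet> v = 0} = range (\<lambda>t. t *\<^sub>R phase_vector b)"
  proof
    show "symplectic_orth {v. b \<bullet> v = 0} \<subseteq> range (\<lambda>t. t *\<^sub>R phase_vector b)"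
    proof
      fix w assume "w \<in> symplectic_orth {v. b \<bullet> v = 0}"
      then have "b \<bullet> v = 0 \<Longrightarrow> (- \<i> * fst w, - \<i> * snd w) \<bullet> v = 0" for v
        unfolding symplectic_orth_def Omega_eq_inner by blast
      from orth_complement_line[OF this] obtain t where "(- \<i> * fst w, - \<i> * snd w) = t *\<^sub>R b"
        by blast
      then have "w = t *\<^sub>R phase_vector b"
        by (auto simp: prod_eq_iff phase_vector_def complex_eq_iff)
      then show "w \<in> range (\<lambda>t. t *\<^sub>R phase_vector b)" by blast
    qed
  qed (auto simp: symplectic_orth_def lin Omega_phase_vector)
  ultimately show "ker_T (R_res 1 1) b = symplectic_orth (ker_T J_11 b) \<and>
      ker_T J_11 b = symplectic_orth (ker_T (R_res 1 1) b)"
    unfolding kers by simp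
qed

section \<open>The dual pair for the resonance n:m\<close>

theorem theorem2p1:
  fixes n m :: nat
  assumes "n > 0" and "m > 0"
  shows "poisson_map Cx2 bracket_C2 UNIV zero_bracket (R_res n m)
    \<and> poisson_map Cx2 bracket_C2 UNIV lie_poisson_plus (J_res n m)
    \<and> dual_pair Cx2 (R_res n m) (J_res n m)
    \<and> (\<forall>a\<in>Cx2. R_res n m a = (R_res 1 1 \<circ> f_res n m) a)
    \<and> (\<forall>a\<in>Cx2. J_res n m a = (J_res 1 1 \<circ> f_res n m) a)"
proof (intro conjI ballI)
  have f: "smooth_on Cx2 (f_res n m)" "f_res n m ` Cx2 \<subseteq> Cx2"
    "\<And>a. a \<in> Cx2 \<Longrightarrow> symplectic_linear (frechet_derivative (f_res n m) (at a))"
    using assms by (auto intro: smooth_on_f_res f_res_in_Cx2 symplectic_f_res)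
  have f_poisson: "poisson_map Cx2 bracket_C2 Cx2 bracket_C2 (f_res n m)"
    by (rule symplectic_poisson_map[OF f])
  have R: "R_res n m = R_res 1 1 \<circ> f_res n m"
    using R_res_eq[OF assms] by blast
  show "poisson_map Cx2 bracket_C2 UNIV zero_bracket (R_res n m)"
    unfolding R by (rule poisson_map_compose[OF f_poisson poisson_map_real[OF smooth_on_R_11]])
  show "poisson_map Cx2 bracket_C2 UNIV lie_poisson_plus (J_res n m)"
    unfolding J_res_def by (rule poisson_map_compose[OF f_poisson poisson_map_J_11])
  show "dual_pair Cx2 (R_res n m) (J_res n m)"
    unfolding R J_res_def
    by (rule dual_pair_symplectic_pullback[OF f smooth_on_R_11 smooth_on_J_11 dual_pair_11])
  show "R_res n m a = (R_res 1 1 \<circ> f_res n m) a" for a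
    by (simp only: R)
  show "J_res n m a = (J_res 1 1 \<circ> f_res n m) a" for a
    unfolding J_res_1_1 unfolding J_res_def ..
qed

end
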